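(* For every $t\in\mathbb{C}\setminus\{0\}$ and every integer $m\ge 0$, $$\left.\frac{\partial J_{\nu}(t)}{\partial\nu}\right|_{\nu=m}+(-1)^{m}\left.\frac{\partial J_{\nu}(t)}{\partial\nu}\right|_{\nu=-m}=\pi\,Y_{m}(t).$$
   Context: $J_\nu(t)=\sum_{k=0}^{\infty}\frac{(-1)^k}{k!\,\Gamma(k+\nu+1)}\left(\frac{t}{2}\right)^{2k+\nu}$ is the Bessel function of the first kind (principal branch, $-\pi<\arg t\le\pi$; $1/\Gamma$ is zero at the poles of $\Gamma$), and $Y_\nu(t)=\frac{J_\nu(t)\cos\pi\nu-J_{-\nu}(t)}{\sin\pi\nu}$ (for integer $\nu$, the limit in $\nu$) is the Bessel function of the second kind. *)

theory Defs
  imports "HOL-Analysis.Analysis"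
begin

text \<open>
  The order and the argument are both complex.  \<^const>\<open>rGamma\<close> is the entire function
  $1/\Gamma$, so the terms with $k + \nu + 1$ a pole of $\Gamma$ vanish as intended, and complex
  \<^term>\<open>(powr)\<close> is the principal branch, $-\pi < \arg \le \pi$.
\<close>

definition bessel_J :: "complex \<Rightarrow> complex \<Rightarrow> complex" where
  "bessel_J \<nu> t =
     (\<Sum>k. (- 1) ^ k / fact k * rGamma (of_nat k + \<nu> + 1) * (t / 2) powr (2 * of_nat k + \<nu>))"

definition bessel_Y_quot :: "complex \<Rightarrow> complex \<Rightarrow> complex" where
  "bessel_Y_quot \<nu> t =
     (bessel_J \<nu> t * cos (of_real pi * \<nu>) - bessel_J (- \<nu>) t) / sin (of_real pi * \<nu>)"

text \<open>
  At an integer order the quotient is $0/0$; the filter \<^term>\<open>at \<nu>\<close> is punctured, so that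
  value plays no role in the limit.
\<close>

definition bessel_Y :: "complex \<Rightarrow> complex \<Rightarrow> complex" where
  "bessel_Y \<nu> t =
     (if \<nu> \<in> \<int> then Lim (at \<nu>) (\<lambda>\<mu>. bessel_Y_quot \<mu> t) else bessel_Y_quot \<nu> t)"

end

theory Submission
  imports Defs "HOL-Complex_Analysis.Cauchy_Integral_Formula"
begin

text \<open>
  The quotient defining \<open>bessel_Y\<close> is $0/0$ at $\nu = m$ because $J_{-m} = (-1)^m J_m$, and
  $J_\nu(t)$ is entire in $\nu$, so its limit is the quotient of the $\nu$-derivatives of
  numerator and denominator.  The series for $J_\nu(t)$ converges locally uniformly in $\nu$: since
  $1/\Gamma(z+1) = (1/\Gamma(z))/z$, the factors $1/\Gamma(k+\nu+1)$ eventually decrease in modulus,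
  and the rest is dominated by the exponential series.
\<close>

lemma norm_rGamma_add_of_nat_le:
  fixes z :: complex
  assumes "1 \<le> Re z"
  shows "norm (rGamma (z + of_nat n)) \<le> norm (rGamma z)"
proof (induction n)
  case (Suc n)
  have "1 \<le> Re (z + of_nat n)"
    using assms by simp
  then have "1 \<le> norm (z + of_nat n)"
    using complex_Re_le_cmod order_trans by blast
  then have "norm (rGamma (z + of_nat n + 1)) \<le> norm ((z + of_nat n) * rGamma (z + of_nat n + 1))"
    by (simp add: norm_mult mult_le_cancel_right1)
  also have "\<dots> = norm (rGamma (z + of_nat n))"
    by (simp only: rGamma_plus1)
  finally show ?case
    using Suc by (simp add: add_ac)
qed simp

definition bessel_J_term :: "complex \<Rightarrow> nat \<Rightarrow> complex \<Rightarrow> complex" where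
  "bessel_J_term t k \<nu> =
     (- 1) ^ k / fact k * rGamma (of_nat k + \<nu> + 1) * (t / 2) powr (2 * of_nat k + \<nu>)"

lemma bessel_J_eq_suminf_term: "bessel_J \<nu> t = (\<Sum>k. bessel_J_term t k \<nu>)"
  by (simp add: bessel_J_def bessel_J_term_def)

text \<open>In the order, the power is the exponential of an affine function, or constantly 0 if
  \<open>t = 0\<close>; the branch cut concerns only \<open>t\<close>.\<close>

lemma holomorphic_on_bessel_J_term: "bessel_J_term t k holomorphic_on A"
  unfolding bessel_J_term_def
  by (cases "t = 0") (auto intro!: holomorphic_intros simp: powr_def)

lemma uniform_limit_bessel_J:
  assumes "t \<noteq> 0"
  shows "uniform_limit (cball a r) (\<lambda>n \<nu>. \<Sum>k<n. bessel_J_term t k \<nu>) (\<lambda>\<nu>. bessel_J \<nu> t) sequentially"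
proof -
  \<comment> \<open>This \<open>N\<close> gives \<open>Re (of_nat N + \<nu> + 1) \<ge> 1\<close> on
    the whole disc, so the decrease of the \<open>rGamma\<close> factors starts at one index for all
    orders there.\<close>
  obtain N :: nat where N: "norm a + r \<le> of_nat N"
    using real_arch_simple by blast
  \<comment> \<open>\<open>g\<close> is what is left of the bound after \<open>rGamma\<close> is
    compared with its value at index \<open>N\<close> and the integer power of \<open>t / 2\<close>
    is split off. It does not depend on \<open>k\<close>, and compactness bounds it.\<close>
  define g where "g \<nu> = rGamma (of_nat N + \<nu> + 1) * (t / 2) powr \<nu>" for \<nu>
  have "g holomorphic_on cball a r"
    unfolding g_def using assms by (auto intro!: holomorphic_intros simp: powr_def)
  then have "bounded (g ` cball a r)"
    by (intro compact_imp_bounded compact_continuous_image holomorphic_on_imp_continuous_on) auto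
  then obtain C where C: "norm (g \<nu>) \<le> C" if "\<nu> \<in> cball a r" for \<nu>
    unfolding bounded_iff by blast
  have bound: "norm (bessel_J_term t k \<nu>) \<le> C * ((norm (t / 2))\<^sup>2 ^ k / fact k)"
    if "N \<le> k" "\<nu> \<in> cball a r" for k \<nu>
  proof -
    have "norm \<nu> \<le> norm a + r"
      using that(2) norm_triangle_ineq2[of \<nu> a] by (simp add: dist_norm norm_minus_commute)
    then have "1 \<le> Re (of_nat N + \<nu> + 1)"
      using N abs_Re_le_cmod[of \<nu>] by simp
    from norm_rGamma_add_of_nat_le[OF this, of "k - N"]
    have le: "norm (rGamma (of_nat k + \<nu> + 1)) \<le> norm (rGamma (of_nat N + \<nu> + 1))"
      using that(1) by (simp add: of_nat_diff algebra_simps)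
    have "(t / 2) powr (2 * of_nat k + \<nu>) = (t / 2) powr of_nat (2 * k) * (t / 2) powr \<nu>"
      by (simp add: powr_add)
    also have "\<dots> = (t / 2) ^ (2 * k) * (t / 2) powr \<nu>"
      using assms by (subst powr_nat') auto
    finally have "norm (bessel_J_term t k \<nu>)
        = norm (rGamma (of_nat k + \<nu> + 1)) * norm ((t / 2) powr \<nu>) * ((norm (t / 2))\<^sup>2 ^ k / fact k)"
      by (simp add: bessel_J_term_def norm_mult norm_divide norm_power power_mult)
    also have "\<dots> \<le> norm (g \<nu>) * ((norm (t / 2))\<^sup>2 ^ k / fact k)"
      unfolding g_def norm_mult using le by (intro mult_right_mono) auto
    also have "\<dots> \<le> C * ((norm (t / 2))\<^sup>2 ^ k / fact k)"
      using C[OF that(2)] by (intro mult_right_mono) auto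
    finally show ?thesis .
  qed
  have "\<forall>\<^sub>F k in sequentially. \<forall>\<nu>\<in>cball a r.
      norm (bessel_J_term t k \<nu>) \<le> C * ((norm (t / 2))\<^sup>2 ^ k / fact k)"
    using eventually_ge_at_top[of N] by eventually_elim (blast intro: bound)
  moreover have "summable (\<lambda>k. C * ((norm (t / 2))\<^sup>2 ^ k / fact k))"
    using summable_exp[of "(norm (t / 2))\<^sup>2"] by (intro summable_mult) (simp add: field_simps)
  ultimately show ?thesis
    unfolding bessel_J_eq_suminf_term by (rule Weierstrass_m_test_ev)
qed

lemma holomorphic_on_bessel_J:
  assumes "t \<noteq> 0"
  shows "(\<lambda>\<nu>. bessel_J \<nu> t) holomorphic_on UNIV"
proof (rule holomorphic_uniform_sequence)
  show "(\<lambda>\<nu>. \<Sum>k<n. bessel_J_term t k \<nu>) holomorphic_on UNIV" for n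
    by (intro holomorphic_intros holomorphic_on_bessel_J_term)
  show "\<exists>d>0. cball x d \<subseteq> UNIV \<and>
      uniform_limit (cball x d) (\<lambda>n \<nu>. \<Sum>k<n. bessel_J_term t k \<nu>) (\<lambda>\<nu>. bessel_J \<nu> t) sequentially" for x
    using uniform_limit_bessel_J[OF assms, of x 1] by (intro exI[of _ 1]) auto
qed auto

text \<open>The first \<open>m\<close> terms at order \<open>-m\<close> vanish at poles of the Gamma
  function; the others are, shifted by \<open>m\<close>, the terms at order \<open>m\<close> up to
  sign.\<close>

lemma bessel_J_minus_of_nat:
  assumes "t \<noteq> 0"
  shows "bessel_J (- of_nat m) t = (- 1) ^ m * bessel_J (of_nat m) t"
proof -
  \<comment> \<open>A disc of radius 0 turns uniform convergence into convergence at its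
    centre.\<close>
  have sums: "(\<lambda>k. bessel_J_term t k \<nu>) sums bessel_J \<nu> t" for \<nu>
    using tendsto_uniform_limitI[OF uniform_limit_bessel_J[OF assms, of \<nu> 0], of \<nu>]
    by (simp add: sums_def)
  have zero: "bessel_J_term t k (- of_nat m) = 0" if "k < m" for k
  proof -
    have "of_nat k + (- of_nat m) + 1 = (- of_nat (m - k - 1) :: complex)"
      using that by (simp add: of_nat_diff)
    then show ?thesis
      unfolding bessel_J_term_def by (simp only: rGamma_eq_zero_iff) simp
  qed
  have rGamma_fact: "rGamma (of_nat n + 1 :: complex) = 1 / fact n" for n
    using Gamma_fact[of n, where 'a = complex]
    by (simp add: rGamma_inverse_Gamma add_ac inverse_eq_divide)
  have shift: "bessel_J_term t (j + m) (- of_nat m) = (- 1) ^ m * bessel_J_term t j (of_nat m)" for j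
  proof -
    \<comment> \<open>With both \<open>rGamma\<close> arguments of the form
      \<open>of_nat n + 1\<close>, each side has the denominator
      \<open>fact j * fact (j + m)\<close>: the explicit factorial and the Gamma factor swap
      roles.\<close>
    have "of_nat (j + m) + - of_nat m + 1 = (of_nat j + 1 :: complex)"
      "of_nat j + of_nat m + 1 = (of_nat (j + m) + 1 :: complex)"
      "2 * of_nat (j + m) + - of_nat m = (2 * of_nat j + of_nat m :: complex)"
      by simp_all
    then show ?thesis
      unfolding bessel_J_term_def by (simp only: rGamma_fact) (simp add: power_add mult_ac)
  qed
  have "(\<lambda>j. bessel_J_term t (j + m) (- of_nat m)) sums bessel_J (- of_nat m) t"
    using sums[of "- of_nat m"] zero by (subst sums_zero_iff_shift) auto
  moreover have "(\<lambda>j. bessel_J_term t (j + m) (- of_nat m)) sums ((- 1) ^ m * bessel_J (of_nat m) t)"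
    unfolding shift by (intro sums_mult sums)
  ultimately show ?thesis
    by (rule sums_unique2)
qed

theorem theorem3p1:
  fixes t :: complex and m :: nat
  assumes "t \<noteq> 0"
  shows "(\<lambda>\<nu>. bessel_J \<nu> t) field_differentiable at (of_nat m) \<and>
    (\<lambda>\<nu>. bessel_J \<nu> t) field_differentiable at (- of_nat m) \<and>
    deriv (\<lambda>\<nu>. bessel_J \<nu> t) (of_nat m)
      + (- 1) ^ m * deriv (\<lambda>\<nu>. bessel_J \<nu> t) (- of_nat m)
    = of_real pi * bessel_Y (of_nat m) t"
proof -
  let ?J = "\<lambda>\<nu>. bessel_J \<nu> t" and ?m = "of_nat m :: complex"
  define L where "L = (deriv ?J ?m + (- 1) ^ m * deriv ?J (- ?m)) / of_real pi"
  have diff: "?J field_differentiable at \<nu>" for \<nu>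
    using holomorphic_on_bessel_J[OF assms] by (simp add: holomorphic_on_def)
  then have D: "(?J has_field_derivative deriv ?J \<nu>) (at \<nu>)" for \<nu>
    by (simp add: DERIV_deriv_iff_field_differentiable)
  have D_minus: "((\<lambda>\<nu>. bessel_J (- \<nu>) t) has_field_derivative - deriv ?J (- ?m)) (at ?m)"
    using DERIV_chain2[OF D DERIV_minus[OF DERIV_ident], of ?m UNIV] by simp
  have cos: "cos (of_real pi * ?m) = (- 1) ^ m"
    using cos_of_real[of "pi * real m", where 'a = complex] by simp
  have sin: "sin (of_real pi * ?m) = 0"
    using sin_of_real[of "pi * real m", where 'a = complex] by simp
  have "((\<lambda>\<mu>. bessel_Y_quot \<mu> t) \<longlongrightarrow> L) (at ?m)"
    unfolding bessel_Y_quot_def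
  proof (rule lhopital_complex_simple)
    \<comment> \<open>The derivative of the cosine contributes nothing, as the sine vanishes at
      \<open>pi * m\<close>; the chain rule's minus sign cancels the subtraction.\<close>
    show "((\<lambda>\<nu>. ?J \<nu> * cos (of_real pi * \<nu>) - bessel_J (- \<nu>) t)
        has_field_derivative deriv ?J ?m * (- 1) ^ m + deriv ?J (- ?m)) (at ?m)"
      by (rule derivative_eq_intros D D_minus refl | simp add: cos sin)+
    show "((\<lambda>\<nu>. sin (of_real pi * \<nu>)) has_field_derivative of_real pi * (- 1) ^ m) (at ?m)"
      by (rule derivative_eq_intros refl | simp add: cos)+
    \<comment> \<open>\<open>(- 1) ^ m\<close> is its own inverse, which moves the sign from the
      first derivative to the second.\<close>
    show "(deriv ?J ?m * (- 1) ^ m + deriv ?J (- ?m)) / (of_real pi * (- 1) ^ m) = L"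
      by (cases "even m") (simp_all add: L_def field_simps)
  \<comment> \<open>What remains is that numerator and denominator vanish at \<open>m\<close>, the
    former by the reflection \<open>-m\<close> to \<open>m\<close>, and that the denominator's
    derivative does not.\<close>
  qed (simp_all add: cos sin bessel_J_minus_of_nat[OF assms])
  then have "bessel_Y ?m t = L"
    by (simp add: bessel_Y_def tendsto_Lim)
  then show ?thesis
    using diff by (simp add: L_def)
qed

end
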